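(* Let $G=(V,E)$ be a locally finite simple graph and let $x\in V$. Then for any $\mathcal N\in(0,\infty]$, $$\mathcal K_{G,x}(\mathcal N)\ge\mathcal K_\infty^0(x)-\frac{2d_x}{\mathcal N}+\frac12\lambda_{\min}\big(\widehat{\mathcal P}_{\mathcal N}(x)\big).$$ This estimate is sharp (i.e. equality holds) if and only if the zero eigenvalue of the matrix $$\widehat{\mathcal P}_{\mathcal N}(x)-\lambda_{\min}\big(\widehat{\mathcal P}_{\mathcal N}(x)\big)\cdot2\Gamma(x)$$ has multiplicity at least $2$.
   Context: Graphs are undirected, without loops or multiple edges, and every vertex has finite degree; $d_x$ is the degree of $x$, and the vertex $x$ considered has $d_x\ge1$. For $f:V\to\mathbb R$ put $\Delta f(x)=\sum_{y\sim x}(f(y)-f(x))$ (non-normalized Laplacian), and for $f,g:V\to\mathbb R$ put $2\Gamma(f,g)=\Delta(fg)-f\Delta g-g\Delta f$, $2\Gamma_2(f,g)=\Delta\Gamma(f,g)-\Gamma(f,\Delta g)-\Gamma(\Delta f,g)$, $\Gamma(f)=\Gamma(f,f)$, $\Gamma_2(f)=\Gamma_2(f,f)$. For $\mathcal N\in(0,\infty]$ (convention $1/\infty=0$), $\mathcal K_{G,x}(\mathcal N)$ is the largest $K\in\mathbb R$ such that $\Gamma_2(f)(x)\ge\frac1{\mathcal N}(\Delta f(x))^2+K\,\Gamma(f)(x)$ for all $f:V\to\mathbb R$ (Bakry-Émery curvature function). $S_r(x)$ is the set of vertices at graph distance $r$ from $x$; $S_1(x)=\{y_1,\dots,y_{d_x}\}$.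 For $y\in S_1(x)$, $d_y^+$ is the number of neighbours of $y$ in $S_2(x)$; for $z\in S_2(x)$, $d_z^-$ is the number of neighbours of $z$ in $S_1(x)$; $w_{uv}=1$ if $u\sim v$ and $0$ otherwise. $av_1^+(x)=\frac1{d_x}\sum_{y\in S_1(x)}d_y^+$ and $\mathcal K_\infty^0(x)=\frac{3+d_x-av_1^+(x)}2$. $\mathcal P_\infty(x)$ is the symmetric $d_x\times d_x$ matrix with entries $(\mathcal P_\infty(x))_{ij}=2-4w_{y_iy_j}-4\sum_{z\in S_2(x)}\frac{w_{y_iz}w_{zy_j}}{d_z^-}$ for $i\ne j$, and $(\mathcal P_\infty(x))_{ii}=-\sum_{j\ne i}(\mathcal P_\infty(x))_{ij}-(d_{y_i}^+-av_1^+(x))$. $\widehat{\mathcal P}_\infty(x)$ is the symmetric $(d_x+1)\times(d_x+1)$ matrix, indexed by $x,y_1,\dots,y_{d_x}$, with $(x,x)$-entry $0$, $(x,y_i)$- and $(y_i,x)$-entries $d_{y_i}^+-av_1^+(x)$, and $(S_1(x),S_1(x))$-block $\mathcal P_\infty(x)$. $\widehat{\mathcal P}_{\mathcal N}(x)=\widehat{\mathcal P}_\infty(x)+\frac4{\mathcal N}\begin{pmatrix}0&0\\0&d_xI_{d_x}-J_{d_x}\end{pmatrix}$, where $I_{d_x}$ is the identity and $J_{d_x}$ the all-ones matrix. $2\Gamma(x)$ is the symmetric $(d_x+1)\times(d_x+1)$ matrix (same indexing) with $(x,x)$-entry $d_x$, $(x,y_i)$- and $(y_i,x)$-entries $-1$,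 and $(S_1(x),S_1(x))$-block $I_{d_x}$. $\lambda_{\min}$ denotes the smallest eigenvalue. *)

theory Defs
  imports
    "HOL-Library.Extended_Nat"
    "HOL-Library.Extended_Real"
    "Jordan_Normal_Form.Spectral_Radius"
begin

text \<open>The vertex set is the whole type \<open>'v\<close>, which may be infinite.\<close>

locale locally_finite_simple_graph =
  fixes E :: "'v \<Rightarrow> 'v \<Rightarrow> bool"
  assumes sym_adj: "symp E"
    and no_loops: "irreflp E"
    and finite_nbhd: "finite {y. E x y}"

definition deg :: "('v \<Rightarrow> 'v \<Rightarrow> bool) \<Rightarrow> 'v \<Rightarrow> nat" where
  "deg E x = card {y. E x y}"

text \<open>Length of a shortest walk, and \<open>\<infinity>\<close> if there is none.\<close>

definition graph_dist :: "('v \<Rightarrow> 'v \<Rightarrow> bool) \<Rightarrow> 'v \<Rightarrow> 'v \<Rightarrow> enat" where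
  "graph_dist E u v = (INF n\<in>{n. (E ^^ n) u v}. enat n)"

definition sphere :: "('v \<Rightarrow> 'v \<Rightarrow> bool) \<Rightarrow> nat \<Rightarrow> 'v \<Rightarrow> 'v set" where
  "sphere E r x = {y. graph_dist E x y = enat r}"

definition laplacian :: "('v \<Rightarrow> 'v \<Rightarrow> bool) \<Rightarrow> ('v \<Rightarrow> real) \<Rightarrow> 'v \<Rightarrow> real" where
  "laplacian E f x = (\<Sum>y\<in>{y. E x y}. f y - f x)"

definition gamma_form ::
    "('v \<Rightarrow> 'v \<Rightarrow> bool) \<Rightarrow> ('v \<Rightarrow> real) \<Rightarrow> ('v \<Rightarrow> real) \<Rightarrow> 'v \<Rightarrow> real" where
  "gamma_form E f g x =
     (laplacian E (\<lambda>v. f v * g v) x - f x * laplacian E g x - g x * laplacian E f x) / 2"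

definition gamma2_form ::
    "('v \<Rightarrow> 'v \<Rightarrow> bool) \<Rightarrow> ('v \<Rightarrow> real) \<Rightarrow> ('v \<Rightarrow> real) \<Rightarrow> 'v \<Rightarrow> real" where
  "gamma2_form E f g x =
     (laplacian E (gamma_form E f g) x - gamma_form E f (laplacian E g) x
        - gamma_form E (laplacian E f) g x) / 2"

text \<open>The dimension \<open>N\<close> ranges over \<open>(0,\<infinity>]\<close>; on \<^typ>\<open>ereal\<close> one has \<open>1 / \<infinity> = 0\<close>.\<close>

definition recip_dim :: "ereal \<Rightarrow> real" where
  "recip_dim N = real_of_ereal (1 / N)"

definition curvature :: "('v \<Rightarrow> 'v \<Rightarrow> bool) \<Rightarrow> 'v \<Rightarrow> ereal \<Rightarrow> real" where
  "curvature E x N =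
     (GREATEST K. \<forall>f. gamma2_form E f f x
        \<ge> recip_dim N * (laplacian E f x)\<^sup>2 + K * gamma_form E f f x)"

text \<open>Here \<open>y \<in> sphere E 1 x\<close> and \<open>z \<in> sphere E 2 x\<close>.\<close>

definition deg_plus :: "('v \<Rightarrow> 'v \<Rightarrow> bool) \<Rightarrow> 'v \<Rightarrow> 'v \<Rightarrow> nat" where
  "deg_plus E x y = card {z \<in> sphere E 2 x. E y z}"

definition deg_minus :: "('v \<Rightarrow> 'v \<Rightarrow> bool) \<Rightarrow> 'v \<Rightarrow> 'v \<Rightarrow> nat" where
  "deg_minus E x z = card {y \<in> sphere E 1 x. E z y}"

definition adj_weight :: "('v \<Rightarrow> 'v \<Rightarrow> bool) \<Rightarrow> 'v \<Rightarrow> 'v \<Rightarrow> real" where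
  "adj_weight E u v = (if E u v then 1 else 0)"

definition av_deg_plus :: "('v \<Rightarrow> 'v \<Rightarrow> bool) \<Rightarrow> 'v \<Rightarrow> real" where
  "av_deg_plus E x = (\<Sum>y\<in>sphere E 1 x. real (deg_plus E x y)) / real (deg E x)"

definition K0_inf :: "('v \<Rightarrow> 'v \<Rightarrow> bool) \<Rightarrow> 'v \<Rightarrow> real" where
  "K0_inf E x = (3 + real (deg E x) - av_deg_plus E x) / 2"

text \<open>
  The list \<open>ys\<close> enumerates the 1-sphere of \<open>x\<close> without repetition. In the matrices of
  size \<open>deg E x\<close>, index \<open>i\<close> stands for \<open>ys ! i\<close>; in those of size \<open>deg E x + 1\<close>, index \<open>0\<close>
  stands for \<open>x\<close> and index \<open>i + 1\<close> for \<open>ys ! i\<close>.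
\<close>

definition P_offdiag :: "('v \<Rightarrow> 'v \<Rightarrow> bool) \<Rightarrow> 'v \<Rightarrow> 'v \<Rightarrow> 'v \<Rightarrow> real" where
  "P_offdiag E x y y' =
     2 - 4 * adj_weight E y y'
       - 4 * (\<Sum>z\<in>sphere E 2 x. adj_weight E y z * adj_weight E z y' / real (deg_minus E x z))"

definition P_inf :: "('v \<Rightarrow> 'v \<Rightarrow> bool) \<Rightarrow> 'v \<Rightarrow> 'v list \<Rightarrow> real mat" where
  "P_inf E x ys = mat (deg E x) (deg E x) (\<lambda>(i, j).
     if i \<noteq> j then P_offdiag E x (ys ! i) (ys ! j)
     else - (\<Sum>k\<in>{..<deg E x} - {i}. P_offdiag E x (ys ! i) (ys ! k))
          - (real (deg_plus E x (ys ! i)) - av_deg_plus E x))"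

definition P_hat_inf :: "('v \<Rightarrow> 'v \<Rightarrow> bool) \<Rightarrow> 'v \<Rightarrow> 'v list \<Rightarrow> real mat" where
  "P_hat_inf E x ys = four_block_mat
     (0\<^sub>m 1 1)
     (mat 1 (deg E x) (\<lambda>(_, j). real (deg_plus E x (ys ! j)) - av_deg_plus E x))
     (mat (deg E x) 1 (\<lambda>(i, _). real (deg_plus E x (ys ! i)) - av_deg_plus E x))
     (P_inf E x ys)"

definition all_ones_mat :: "nat \<Rightarrow> real mat" where
  "all_ones_mat n = mat n n (\<lambda>_. 1)"

definition P_hat :: "('v \<Rightarrow> 'v \<Rightarrow> bool) \<Rightarrow> 'v \<Rightarrow> 'v list \<Rightarrow> ereal \<Rightarrow> real mat" where
  "P_hat E x ys N = P_hat_inf E x ys + (4 * recip_dim N) \<cdot>\<^sub>m four_block_mat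
     (0\<^sub>m 1 1) (0\<^sub>m 1 (deg E x))
     (0\<^sub>m (deg E x) 1) (real (deg E x) \<cdot>\<^sub>m 1\<^sub>m (deg E x) - all_ones_mat (deg E x))"

text \<open>The matrix of \<open>2\<Gamma>(x)\<close>, the factor 2 included.\<close>

definition two_Gamma_mat :: "('v \<Rightarrow> 'v \<Rightarrow> bool) \<Rightarrow> 'v \<Rightarrow> real mat" where
  "two_Gamma_mat E x = four_block_mat
     (mat 1 1 (\<lambda>_. real (deg E x))) (mat 1 (deg E x) (\<lambda>_. - 1))
     (mat (deg E x) 1 (\<lambda>_. - 1)) (1\<^sub>m (deg E x))"

definition lambda_min :: "real mat \<Rightarrow> real" where
  "lambda_min A = Min (spectrum A)"

definition eigenvalue_multiplicity :: "real mat \<Rightarrow> real \<Rightarrow> nat" where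
  "eigenvalue_multiplicity A a = Polynomial.order a (char_poly A)"

end

theory Submission
  imports Defs "HOL-Analysis.Function_Topology"
begin

text \<open>
  Normalise \<open>f x = 0\<close> and let \<open>a\<close> be the vector of values of \<open>f\<close> on the 1-sphere. Completing squares
  in the values on the 2-sphere shows that the minimum of \<open>\<Gamma>\<^sub>2(f)(x) - (\<Delta>f(x))\<^sup>2 / N\<close> for given \<open>a\<close> is
  \<open>(K0_inf E x - 2 d / N) \<Gamma>(f)(x) + a \<bullet> D a / 4\<close>, where \<open>D\<close> is the block of \<open>P_hat\<close> indexed by the
  1-sphere. Since \<open>\<Gamma>(f)(x) = a \<bullet> a / 2\<close>, the curvature is \<open>K0_inf E x - 2 d / N + \<lambda>\<^sub>m\<^sub>i\<^sub>n(D) / 2\<close>, and the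
  estimate is the interlacing inequality for a principal submatrix.

  The rows of \<open>P_hat\<close> and of \<open>2\<Gamma>(x)\<close> sum to zero, hence so do those of
  \<open>B = P_hat - \<lambda>\<^sub>m\<^sub>i\<^sub>n(P_hat) \<cdot> 2\<Gamma>(x)\<close>, which makes the constants a kernel of \<open>B\<close>. Splitting them off
  removes one factor \<open>X\<close> from the characteristic polynomial; a second factor occurs iff \<open>B\<close> kills a
  nonzero vector vanishing at \<open>x\<close>, that is, iff \<open>\<lambda>\<^sub>m\<^sub>i\<^sub>n(P_hat)\<close> is also an eigenvalue of \<open>D\<close>.
\<close>

section \<open>Smallest eigenvalues of real symmetric matrices\<close>

text \<open>The unit sphere is compact, so the continuous form \<open>q\<close> attains a minimum on
  it. Homogeneity of degree two turns minimality there into the inequality for every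
  \<open>v\<close>.\<close>

lemma quadratic_form_attains_min:
  fixes a :: "nat \<Rightarrow> nat \<Rightarrow> real"
  assumes "0 < n"
  defines "q \<equiv> \<lambda>u. \<Sum>i<n. \<Sum>j<n. a i j * u i * u j"
  shows "\<exists>u. (\<Sum>i<n. (u i)\<^sup>2) = 1 \<and> (\<forall>v. q u * (\<Sum>i<n. (v i)\<^sup>2) \<le> q v)"
proof -
  \<comment> \<open>Vectors are functions on all of \<open>nat\<close>. Pinning the coordinates from
    \<open>n\<close> on to 0 makes the box a product of compact sets, and the unit sphere is a
    closed part of it.\<close>
  let ?box = "PiE UNIV (\<lambda>i::nat. if i < n then {-1..1} else {0::real})"
  let ?S = "?box \<inter> {u. (\<Sum>i<n. (u i)\<^sup>2) = 1}"
  have "compactin (product_topology (\<lambda>_. euclidean) UNIV) ?box"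
    by (auto simp: compactin_PiE)
  hence "compact ?box"
    by (simp add: euclidean_product_topology)
  moreover have "closed {u. (\<Sum>i<n. (u i)\<^sup>2) = (1::real)}"
    by (intro closed_Collect_eq continuous_intros continuous_on_product_coordinates)
  ultimately have "compact ?S" by (rule compact_Int_closed)
  \<comment> \<open>The first unit vector shows that the sphere is nonempty; this uses
    \<open>0 < n\<close>.\<close>
  moreover have "(\<Sum>i<n. (if i = 0 then 1 else 0)\<^sup>2) = (\<Sum>i<n. if i = 0 then 1 else 0 :: real)"
    by (rule sum.cong) auto
  hence "(\<lambda>i. if i = 0 then 1 else 0) \<in> ?S"
    using \<open>0 < n\<close> by auto
  hence "?S \<noteq> {}" by blast
  moreover have "continuous_on ?S q"
    unfolding q_def
    by (intro continuous_intros continuous_on_subset[OF continuous_on_product_coordinates] subset_UNIV)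
  ultimately obtain u where u: "u \<in> ?S" and min: "\<And>w. w \<in> ?S \<Longrightarrow> q u \<le> q w"
    using continuous_attains_inf by metis
  have "q u * (\<Sum>i<n. (v i)\<^sup>2) \<le> q v" for v
  proof (cases "(\<Sum>i<n. (v i)\<^sup>2) = 0")
    case True
    hence "\<forall>i<n. v i = 0" by (simp add: sum_nonneg_eq_0_iff)
    hence "q v = 0" by (simp add: q_def)
    thus ?thesis using True by simp
  next
    case False
    define s where "s = (\<Sum>i<n. (v i)\<^sup>2)"
    have "s > 0" using False sum_nonneg[of "{..<n}" "\<lambda>i. (v i)\<^sup>2"] by (simp add: s_def)
    define w where "w = (\<lambda>i. if i < n then v i / sqrt s else 0)"
    have w2: "(\<Sum>i<n. (w i)\<^sup>2) = 1"
      using \<open>s > 0\<close> by (simp add: w_def power_divide sum_divide_distrib[symmetric] s_def[symmetric])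
    have "\<bar>w i\<bar> \<le> 1" if "i < n" for i
    proof -
      have "(w i)\<^sup>2 \<le> (\<Sum>i<n. (w i)\<^sup>2)"
        using that by (intro member_le_sum) auto
      thus ?thesis using w2 by (simp add: abs_square_le_1)
    qed
    hence "w i \<in> {-1..1}" if "i < n" for i using that by (simp add: abs_le_iff minus_le_iff)
    moreover have "w i = 0" if "\<not> i < n" for i using that by (simp add: w_def)
    ultimately have "w \<in> ?S" using w2 by auto
    hence "q u \<le> q w" by (rule min)
    moreover have "q w = q v / s"
      using \<open>s > 0\<close> by (simp add: q_def w_def sum_divide_distrib)
    ultimately show ?thesis using \<open>s > 0\<close> by (simp add: s_def[symmetric] pos_le_divide_eq)
  qed
  thus ?thesis using u by blast
qed

lemma scalar_prod_self_pos:
  fixes v :: "real vec"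
  assumes "v \<in> carrier_vec n" "v \<noteq> 0\<^sub>v n"
  shows "0 < v \<bullet> v"
proof -
  obtain i where i: "i < n" "v $ i \<noteq> 0" using assms by (auto simp: vec_eq_iff)
  have "0 < (v $ i)\<^sup>2" using i by simp
  also have "\<dots> \<le> (\<Sum>i<n. (v $ i)\<^sup>2)" using i by (intro member_le_sum) auto
  also have "\<dots> = v \<bullet> v" using assms by (simp add: scalar_prod_def power2_eq_square lessThan_atLeast0)
  finally show ?thesis .
qed

lemma quadratic_form_vec:
  fixes A :: "real mat"
  assumes "A \<in> carrier_mat n n"
  shows "vec n u \<bullet> (A *\<^sub>v vec n u) = (\<Sum>i<n. \<Sum>j<n. A $$ (i, j) * u i * u j)"
  using assms
  by (auto simp: scalar_prod_def lessThan_atLeast0 sum_distrib_left algebra_simps intro!: sum.cong)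

lemma scalar_prod_symmetric:
  fixes A :: "real mat"
  assumes "A \<in> carrier_mat n n" "transpose_mat A = A" "u \<in> carrier_vec n" "v \<in> carrier_vec n"
  shows "u \<bullet> (A *\<^sub>v v) = v \<bullet> (A *\<^sub>v u)"
  using transpose_vec_mult_scalar[of A n n v u] assms
  by (metis comm_scalar_prod mult_mat_vec_carrier)

text \<open>First-order condition at a minimum: moving \<open>u\<close> in the direction of the
  residual \<open>w = A u - m u\<close> changes the nonnegative excess by
  \<open>2 t |w|^2 + t^2 d\<close>, which is negative for some \<open>t\<close> unless
  \<open>w = 0\<close>.\<close>

lemma rayleigh_minimizer_eigenvector:
  fixes A :: "real mat"
  assumes A: "A \<in> carrier_mat n n" and symm: "transpose_mat A = A"
    and u: "u \<in> carrier_vec n"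
    and le: "\<And>v. v \<in> carrier_vec n \<Longrightarrow> m * (v \<bullet> v) \<le> v \<bullet> (A *\<^sub>v v)"
    and eq: "u \<bullet> (A *\<^sub>v u) = m * (u \<bullet> u)"
  shows "A *\<^sub>v u = m \<cdot>\<^sub>v u"
proof (rule ccontr)
  assume ne: "A *\<^sub>v u \<noteq> m \<cdot>\<^sub>v u"
  define w where "w = A *\<^sub>v u - m \<cdot>\<^sub>v u"
  have w: "w \<in> carrier_vec n" using A u by (simp add: w_def)
  have Au: "A *\<^sub>v u \<in> carrier_vec n" and Aw: "A *\<^sub>v w \<in> carrier_vec n"
    using A u w by auto
  have "w \<noteq> 0\<^sub>v n"
  proof
    assume "w = 0\<^sub>v n"
    hence "A *\<^sub>v u = m \<cdot>\<^sub>v u"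
      using A u unfolding w_def by (auto simp: vec_eq_iff)
    with ne show False ..
  qed
  hence pos: "0 < w \<bullet> w" using w scalar_prod_self_pos by blast
  have ww: "w \<bullet> (A *\<^sub>v u) - m * (w \<bullet> u) = w \<bullet> w"
  proof -
    have "w \<bullet> w = w \<bullet> (A *\<^sub>v u - m \<cdot>\<^sub>v u)" by (simp add: w_def)
    also have "\<dots> = w \<bullet> (A *\<^sub>v u) - m * (w \<bullet> u)"
      using w u Au by (subst scalar_prod_minus_distrib[of _ n]) auto
    finally show ?thesis by simp
  qed
  define d where "d = w \<bullet> (A *\<^sub>v w) - m * (w \<bullet> w)"
  have ineq: "0 \<le> 2 * t * (w \<bullet> w) + t\<^sup>2 * d" for t
  proof -
    have c: "u + t \<cdot>\<^sub>v w \<in> carrier_vec n" using u w by simp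
    have 1: "A *\<^sub>v (u + t \<cdot>\<^sub>v w) = A *\<^sub>v u + t \<cdot>\<^sub>v (A *\<^sub>v w)"
      using A u w by (simp add: mult_add_distrib_mat_vec[OF A] mult_mat_vec[OF A])
    have expand: "(u + t \<cdot>\<^sub>v w) \<bullet> (p + t \<cdot>\<^sub>v q) = u \<bullet> p + t * (u \<bullet> q) + t * (w \<bullet> p) + t\<^sup>2 * (w \<bullet> q)"
      if "p \<in> carrier_vec n" "q \<in> carrier_vec n" for p q
      using that u w
      by (simp add: add_scalar_prod_distrib[of _ n] scalar_prod_add_distrib[of _ n] power2_eq_square algebra_simps)
    have "u \<bullet> w = w \<bullet> u" "u \<bullet> (A *\<^sub>v w) = w \<bullet> (A *\<^sub>v u)"
      using scalar_prod_symmetric[OF A symm u w] comm_scalar_prod[OF u w] by auto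
    thus ?thesis
      using le[OF c] unfolding 1 expand[OF u w] expand[OF Au Aw] using eq ww
      by (simp add: d_def algebra_simps)
  qed
  \<comment> \<open>\<open>t = -1\<close> gives \<open>d >= 2 |w|^2\<close>. With \<open>d\<close>
    positive, the quadratic in \<open>t\<close> is smallest at \<open>t = - |w|^2 / d\<close>, where
    its value is \<open>- |w|^4 / d\<close>.\<close>
  have d: "d > 0" using ineq[of "-1"] pos by simp
  have "2 * (- (w \<bullet> w) / d) * (w \<bullet> w) + (- (w \<bullet> w) / d)\<^sup>2 * d = - ((w \<bullet> w)\<^sup>2 / d)"
    using d by (simp add: power2_eq_square field_simps)
  moreover have "(w \<bullet> w)\<^sup>2 / d > 0" using pos d by simp
  ultimately show False using ineq[of "- (w \<bullet> w) / d"] by linarith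
qed

text \<open>A minimiser on the unit sphere is an eigenvector whose eigenvalue \<open>m\<close> is
  the minimum. Every other eigenvalue is the Rayleigh quotient of its eigenvector, hence at least
  \<open>m\<close>, so the \<open>Min\<close> over the finite spectrum is \<open>m\<close>.\<close>

lemma
  fixes A :: "real mat"
  assumes A: "A \<in> carrier_mat n n" and symm: "transpose_mat A = A" and n: "0 < n"
  shows eigenvalue_lambda_min: "eigenvalue A (lambda_min A)"
    and lambda_min_rayleigh: "\<And>v. v \<in> carrier_vec n \<Longrightarrow> lambda_min A * (v \<bullet> v) \<le> v \<bullet> (A *\<^sub>v v)"
    and lambda_min_le: "\<And>k. eigenvalue A k \<Longrightarrow> lambda_min A \<le> k"
proof -
  obtain u0 where u0: "(\<Sum>i<n. (u0 i)\<^sup>2) = 1"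
    and min: "\<And>v. (\<Sum>i<n. \<Sum>j<n. A $$ (i, j) * u0 i * u0 j) * (\<Sum>i<n. (v i)\<^sup>2)
                \<le> (\<Sum>i<n. \<Sum>j<n. A $$ (i, j) * v i * v j)"
    using quadratic_form_attains_min[OF n, of "\<lambda>i j. A $$ (i, j)"] by blast
  define u where "u = vec n u0"
  define m where "m = u \<bullet> (A *\<^sub>v u)"
  have u: "u \<in> carrier_vec n" by (simp add: u_def)
  have uu: "u \<bullet> u = 1"
    using u0 by (simp add: u_def scalar_prod_def power2_eq_square lessThan_atLeast0)
  have le: "m * (v \<bullet> v) \<le> v \<bullet> (A *\<^sub>v v)" if v: "v \<in> carrier_vec n" for v
  proof -
    have "v = vec n (\<lambda>i. v $ i)" using v by auto
    moreover have "v \<bullet> v = (\<Sum>i<n. (v $ i)\<^sup>2)"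
      using v by (simp add: scalar_prod_def power2_eq_square lessThan_atLeast0)
    ultimately show ?thesis
      using min[of "\<lambda>i. v $ i"] quadratic_form_vec[OF A] unfolding m_def u_def by metis
  qed
  have "A *\<^sub>v u = m \<cdot>\<^sub>v u"
    by (rule rayleigh_minimizer_eigenvector[OF A symm u le]) (simp_all add: m_def uu)
  moreover have "u \<noteq> 0\<^sub>v n" using uu by auto
  ultimately have ev: "eigenvalue A m"
    using A u by (auto simp: eigenvalue_def eigenvector_def)
  have ge: "m \<le> k" if k: "eigenvalue A k" for k
  proof -
    obtain v where v: "v \<in> carrier_vec n" "v \<noteq> 0\<^sub>v n" "A *\<^sub>v v = k \<cdot>\<^sub>v v"
      using k A by (auto simp: eigenvalue_def eigenvector_def)
    hence "m * (v \<bullet> v) \<le> k * (v \<bullet> v)" using le[of v] by simp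
    thus ?thesis using scalar_prod_self_pos[OF v(1,2)] by simp
  qed
  have "lambda_min A = m"
    unfolding lambda_min_def using ev ge card_finite_spectrum(1)[OF A]
    by (intro Min_eqI) (auto simp: spectrum_def)
  thus "eigenvalue A (lambda_min A)" "\<And>v. v \<in> carrier_vec n \<Longrightarrow> lambda_min A * (v \<bullet> v) \<le> v \<bullet> (A *\<^sub>v v)"
    "\<And>k. eigenvalue A k \<Longrightarrow> lambda_min A \<le> k"
    using ev le ge by auto
qed

section \<open>Matrices with zero row sums\<close>

text \<open>Base change to the basis \<open>1, e\<^sub>1, \<dots>, e\<^sub>n\<close>, where \<open>1\<close> is the all-ones vector in the kernel of \<open>B\<close>.\<close>

lemma char_poly_zero_row_sums:
  fixes B :: "'a :: field mat"
  assumes B: "B \<in> carrier_mat (Suc n) (Suc n)"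
    and rows: "\<And>i. i \<le> n \<Longrightarrow> (\<Sum>j\<le>n. B $$ (i, j)) = 0"
  shows "char_poly B = [:0, 1:] * char_poly (mat n n (\<lambda>(i, j). B $$ (Suc i, Suc j) - B $$ (0, Suc j)))"
    (is "_ = _ * char_poly ?C")
proof -
  \<comment> \<open>The columns of \<open>S\<close> are the new basis vectors and \<open>S'\<close>
    is the inverse of \<open>S\<close>. The first column of \<open>T\<close>, the matrix of
    \<open>B\<close> in this basis, vanishes because \<open>B\<close> kills the all-ones
    vector.\<close>
  define S :: "'a mat" where "S = mat (Suc n) (Suc n) (\<lambda>(i, j). if j = 0 \<or> i = j then 1 else 0)"
  define S' :: "'a mat" where
    "S' = mat (Suc n) (Suc n) (\<lambda>(i, j). if i = j then 1 else if j = 0 then - 1 else 0)"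
  define T where "T = four_block_mat (0\<^sub>m 1 1) (mat 1 n (\<lambda>(_, j). B $$ (0, Suc j))) (0\<^sub>m n 1) ?C"
  have C: "S \<in> carrier_mat (Suc n) (Suc n)" "S' \<in> carrier_mat (Suc n) (Suc n)"
    by (simp_all add: S_def S'_def)
  have T: "T \<in> carrier_mat (Suc n) (Suc n)"
    unfolding T_def by (auto intro: four_block_carrier_mat)
  have entry: "(X * Y) $$ (i, j) = X $$ (i, 0) * Y $$ (0, j) + (\<Sum>k<n. X $$ (i, Suc k) * Y $$ (Suc k, j))"
    if "X \<in> carrier_mat (Suc n) (Suc n)" "Y \<in> carrier_mat (Suc n) (Suc n)" "i < Suc n" "j < Suc n"
    for X Y :: "'a mat" and i j
  proof -
    have "(X * Y) $$ (i, j) = (\<Sum>k<Suc n. X $$ (i, k) * Y $$ (k, j))"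
      using that by (simp add: scalar_prod_def lessThan_atLeast0 del: sum.op_ivl_Suc)
    thus ?thesis by (simp only: sum.lessThan_Suc_shift)
  qed
  have S: "S $$ (i, j) = (if j = 0 \<or> i = j then 1 else 0)"
    and S': "S' $$ (i, j) = (if i = j then 1 else if j = 0 then - 1 else 0)"
    if "i < Suc n" "j < Suc n" for i j
    using that by (simp_all add: S_def S'_def)
  have mult_S: "M * S = mat (Suc n) (Suc n)
      (\<lambda>(i, j). if j = 0 then M $$ (i, 0) + (\<Sum>k<n. M $$ (i, Suc k)) else M $$ (i, j))"
    if M: "M \<in> carrier_mat (Suc n) (Suc n)" for M
  proof (rule eq_matI, goal_cases)
    case (1 i j)
    hence ij: "i < Suc n" "j < Suc n" by auto
    show ?case
    proof (cases j)
      case 0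
      thus ?thesis using ij by (simp add: entry[OF M C(1)] S)
    next
      case (Suc j')
      thus ?thesis using ij by (simp add: entry[OF M C(1)] S if_distrib[of "\<lambda>x. a * x" for a] cong: if_cong)
    qed
  qed (use M C in auto)
  have S'_mult: "S' * M = mat (Suc n) (Suc n)
      (\<lambda>(i, j). if i = 0 then M $$ (0, j) else M $$ (i, j) - M $$ (0, j))"
    if M: "M \<in> carrier_mat (Suc n) (Suc n)" for M
  proof (rule eq_matI, goal_cases)
    case (1 i j)
    hence ij: "i < Suc n" "j < Suc n" by auto
    show ?case
    proof (cases i)
      case 0
      thus ?thesis using ij by (simp add: entry[OF C(2) M] S')
    next
      case (Suc i')
      thus ?thesis using ij by (simp add: entry[OF C(2) M] S' if_distrib[of "\<lambda>x. x * a" for a] cong: if_cong)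
    qed
  qed (use M C in auto)
  have S'S: "S' * S = 1\<^sub>m (Suc n)"
    unfolding S'_mult[OF C(1)] by (rule eq_matI) (auto simp: S)
  have SS': "S * S' = 1\<^sub>m (Suc n)"
    using mat_mult_left_right_inverse[OF C(2,1) S'S] .
  have row_sum: "B $$ (i, 0) + (\<Sum>k<n. B $$ (i, Suc k)) = 0" if "i < Suc n" for i
    using rows[of i] that by (simp add: lessThan_Suc_atMost[symmetric] sum.lessThan_Suc_shift del: sum.lessThan_Suc)
  have BS: "B * S \<in> carrier_mat (Suc n) (Suc n)" using B C by simp
  have "T = S' * (B * S)"
    unfolding S'_mult[OF BS] unfolding mult_S[OF B]
  proof (rule eq_matI, goal_cases)
    case (1 i j)
    hence "i < Suc n" "j < Suc n" by auto
    thus ?case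
      by (cases i; cases j) (simp_all add: T_def row_sum)
  qed (use T in auto)
  hence "T = S' * B * S" using B C by (simp add: assoc_mult_mat)
  hence "similar_mat T B"
    using B C T SS' S'S by (intro similar_matI[where n = "Suc n" and P = S' and Q = S]) auto
  hence "char_poly B = char_poly T" by (simp add: char_poly_similar)
  also have "\<dots> = char_poly (0\<^sub>m 1 1) * char_poly ?C"
    unfolding T_def by (rule char_poly_four_block_zeros_col) auto
  also have "char_poly (0\<^sub>m 1 1 :: 'a mat) = [:0, 1:]"
    by (simp add: char_poly_defs det_single)
  finally show ?thesis .
qed

text \<open>The matrix part of the argument, free of graphs. The inequality tests the Rayleigh
  quotient of \<open>P\<close> on vectors with zero first coordinate. For the equality case, the
  block of \<open>G\<close> complementary to index 0 is the identity, so there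
  \<open>P - l G\<close> is \<open>D - l I\<close>.\<close>

lemma bordered_lambda_min:
  fixes P :: "real mat" and n :: nat
  defines "D \<equiv> mat n n (\<lambda>(i, j). P $$ (Suc i, Suc j))"
    and "G \<equiv> four_block_mat (mat 1 1 (\<lambda>_. real n)) (mat 1 n (\<lambda>_. - 1))
             (mat n 1 (\<lambda>_. - 1)) (1\<^sub>m n)"
  assumes P: "P \<in> carrier_mat (Suc n) (Suc n)" and symm: "transpose_mat P = P" and n: "0 < n"
    and rows: "\<And>i. i \<le> n \<Longrightarrow> (\<Sum>j\<le>n. P $$ (i, j)) = 0"
  shows "lambda_min P \<le> lambda_min D"
    and "lambda_min D = lambda_min P \<longleftrightarrow>
         eigenvalue_multiplicity (P - lambda_min P \<cdot>\<^sub>m G) 0 \<ge> 2"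
proof -
  have D: "D \<in> carrier_mat n n" by (simp add: D_def)
  have P_sym: "P $$ (i, j) = P $$ (j, i)" if "i < Suc n" "j < Suc n" for i j
    using that P symm index_transpose_mat(1)[of i P j] by (metis carrier_matD)
  have D_sym: "transpose_mat D = D"
    by (rule eq_matI) (auto simp: D_def P_sym)
  have ev_D: "eigenvalue D k \<longleftrightarrow> (\<exists>w \<in> carrier_vec n. w \<noteq> 0\<^sub>v n \<and> D *\<^sub>v w = k \<cdot>\<^sub>v w)" for k
    using D by (auto simp: eigenvalue_def eigenvector_def)
  show le: "lambda_min P \<le> lambda_min D"
  proof -
    obtain w where w: "w \<in> carrier_vec n" "w \<noteq> 0\<^sub>v n" "D *\<^sub>v w = lambda_min D \<cdot>\<^sub>v w"
      using eigenvalue_lambda_min[OF D D_sym n] ev_D by blast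
    \<comment> \<open>The entry at index 0 is irrelevant below: it is paired with the zero
      coordinate of \<open>vCons 0 w\<close>.\<close>
    have Pw: "P *\<^sub>v vCons 0 w = vCons (row P 0 \<bullet> vCons 0 w) (D *\<^sub>v w)"
    proof (rule eq_vecI, goal_cases)
      case (1 i)
      show ?case
        using 1 P w(1)
        by (cases i)
          (auto simp: D_def scalar_prod_def lessThan_atLeast0[symmetric] sum.lessThan_Suc_shift
            simp del: sum.lessThan_Suc)
    qed (use P w in \<open>auto simp: D_def\<close>)
    have "vCons 0 w \<bullet> (P *\<^sub>v vCons 0 w) = lambda_min D * (w \<bullet> w)"
      unfolding Pw using w by simp
    moreover have "vCons 0 w \<bullet> vCons 0 w = w \<bullet> w" by simp
    ultimately have "lambda_min P * (w \<bullet> w) \<le> lambda_min D * (w \<bullet> w)"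
      using lambda_min_rayleigh[OF P symm, of "vCons 0 w"] w(1) by simp
    thus ?thesis using scalar_prod_self_pos[OF w(1,2)] by simp
  qed
  define l where "l = lambda_min P"
  define B where "B = P - l \<cdot>\<^sub>m G"
  \<comment> \<open>\<open>C\<close> is the matrix that remains once the constants are split off
    from \<open>B\<close>.\<close>
  define C where "C = mat n n (\<lambda>(i, j). B $$ (Suc i, Suc j) - B $$ (0, Suc j))"
  have C: "C \<in> carrier_mat n n" by (simp add: C_def)
  have G: "G \<in> carrier_mat (Suc n) (Suc n)" unfolding G_def by (auto intro: four_block_carrier_mat)
  have G_entry: "G $$ (i, j) =
      (if i = 0 \<and> j = 0 then real n else if i = 0 \<or> j = 0 then - 1 else if i = j then 1 else 0)"
    if "i < Suc n" "j < Suc n" for i j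
    using that by (cases i; cases j) (auto simp: G_def)
  have B: "B \<in> carrier_mat (Suc n) (Suc n)"
    unfolding B_def by (intro minus_carrier_mat smult_carrier_mat G)
  have B_entry: "B $$ (i, j) = P $$ (i, j) - l * G $$ (i, j)" if "i < Suc n" "j < Suc n" for i j
    using that P G by (simp add: B_def)
  have B_sym: "B $$ (i, j) = B $$ (j, i)" if "i < Suc n" "j < Suc n" for i j
    using that by (simp add: B_entry G_entry P_sym)
  have G_rows: "(\<Sum>j\<le>n. G $$ (i, j)) = 0" if "i \<le> n" for i
    using that
    by (cases i) (simp_all add: lessThan_Suc_atMost[symmetric] sum.lessThan_Suc_shift G_entry cong: if_cong del: sum.lessThan_Suc)
  have B_rows: "(\<Sum>j\<le>n. B $$ (i, j)) = 0" if "i \<le> n" for i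
    using that rows[OF that] G_rows[OF that]
    by (simp add: B_entry sum_subtractf sum_distrib_left[symmetric])
  \<comment> \<open>By symmetry the columns of \<open>B\<close> sum to zero as well; the border
    entry is moved to the right-hand side.\<close>
  have B_cols: "(\<Sum>i<n. B $$ (Suc i, Suc j)) = - B $$ (0, Suc j)" if "j < n" for j
  proof -
    have "0 = (\<Sum>i<Suc n. B $$ (Suc j, i))"
      using B_rows[of "Suc j"] that by (simp add: lessThan_Suc_atMost)
    also have "\<dots> = B $$ (Suc j, 0) + (\<Sum>i<n. B $$ (Suc j, Suc i))"
      by (rule sum.lessThan_Suc_shift)
    also have "\<dots> = B $$ (0, Suc j) + (\<Sum>i<n. B $$ (Suc i, Suc j))"
      using that by (intro arg_cong2[where f = "(+)"] sum.cong B_sym refl) auto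
    finally show ?thesis by simp
  qed
  \<comment> \<open>Here \<open>e = (D - l I) w\<close>, and \<open>b\<close> is the first entry of
    \<open>B\<close> applied to \<open>vCons 0 w\<close>. \<open>C w = 0\<close> says that
    \<open>e\<close> is constantly \<open>b\<close>; zero column sums give \<open>n b = - b\<close>,
    so \<open>b = 0\<close> and \<open>e = 0\<close>. Conversely, \<open>e = 0\<close> forces
    \<open>b = 0\<close>.\<close>
  have kernel: "C *\<^sub>v w = 0\<^sub>v n \<longleftrightarrow> D *\<^sub>v w = l \<cdot>\<^sub>v w" if w: "w \<in> carrier_vec n" for w
  proof -
    define e where "e i = (\<Sum>j<n. B $$ (Suc i, Suc j) * w $ j)" for i
    define b where "b = (\<Sum>j<n. B $$ (0, Suc j) * w $ j)"
    have Cw: "(C *\<^sub>v w) $ i = e i - b" if "i < n" for i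
      using that w
      by (simp add: C_def scalar_prod_def lessThan_atLeast0[symmetric] e_def b_def
          sum_subtractf[symmetric] left_diff_distrib)
    have Dw: "(D *\<^sub>v w) $ i - l * w $ i = e i" if "i < n" for i
    proof -
      have "e i = (\<Sum>j<n. P $$ (Suc i, Suc j) * w $ j - (if j = i then l * w $ j else 0))"
        unfolding e_def using that by (intro sum.cong) (auto simp: B_entry G_entry left_diff_distrib)
      also have "\<dots> = (D *\<^sub>v w) $ i - l * w $ i"
        using that w by (simp add: D_def scalar_prod_def lessThan_atLeast0[symmetric] sum_subtractf)
      finally show ?thesis by simp
    qed
    have "(\<Sum>i<n. e i) = (\<Sum>j<n. (\<Sum>i<n. B $$ (Suc i, Suc j)) * w $ j)"
      unfolding e_def sum_distrib_right by (rule sum.swap)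
    also have "\<dots> = - b"
      by (simp add: B_cols b_def sum_negf)
    finally have e_sum: "(\<Sum>i<n. e i) = - b" .
    have "(\<forall>i<n. e i = b) \<longleftrightarrow> (\<forall>i<n. e i = 0)"
    proof
      assume *: "\<forall>i<n. e i = b"
      hence "(\<Sum>i<n. e i) = real n * b" by simp
      hence "(real n + 1) * b = 0" using e_sum by (simp add: algebra_simps)
      hence "b = 0" by (simp add: add_nonneg_eq_0_iff)
      thus "\<forall>i<n. e i = 0" using * by simp
    qed (use e_sum in simp)
    moreover have "C *\<^sub>v w = 0\<^sub>v n \<longleftrightarrow> (\<forall>i<n. e i = b)"
      using C by (simp add: vec_eq_iff Cw del: index_mult_mat_vec)
    moreover have "D *\<^sub>v w = l \<cdot>\<^sub>v w \<longleftrightarrow> (\<forall>i<n. e i = 0)"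
      using D w by (simp add: vec_eq_iff Dw[symmetric] del: index_mult_mat_vec)
    ultimately show ?thesis by simp
  qed
  have char_B: "char_poly B = [:0, 1:] * char_poly C"
    unfolding C_def by (rule char_poly_zero_row_sums[OF B B_rows])
  \<comment> \<open>A characteristic polynomial is monic, hence nonzero, so its order at 0 is at
    least 2 exactly when \<open>X^2\<close> divides it.\<close>
  have "eigenvalue_multiplicity B 0 \<ge> 2 \<longleftrightarrow> [:0, 1:] * [:0, 1:] dvd char_poly B"
    using degree_monic_char_poly[OF B] order_divides[of 0 2 "char_poly B"]
    by (auto simp: eigenvalue_multiplicity_def power2_eq_square)
  also have "\<dots> \<longleftrightarrow> [:0, 1:] dvd char_poly C"
    unfolding char_B
    by (rule dvd_times_left_cancel_iff) simp
  also have "\<dots> \<longleftrightarrow> eigenvalue C 0"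
    using poly_eq_0_iff_dvd[of "char_poly C" 0] by (simp add: eigenvalue_root_char_poly[OF C])
  also have "\<dots> \<longleftrightarrow> eigenvalue D l"
  proof -
    have "0 \<cdot>\<^sub>v w = 0\<^sub>v n" if "w \<in> carrier_vec n" for w :: "real vec" using that by auto
    thus ?thesis
      unfolding ev_D using C kernel by (auto simp: eigenvalue_def eigenvector_def)
  qed
  \<comment> \<open>As \<open>l\<close> is at most every eigenvalue of \<open>D\<close>, it can be
    one only by being the smallest.\<close>
  also have "\<dots> \<longleftrightarrow> lambda_min D = l"
    using le eigenvalue_lambda_min[OF D D_sym n] lambda_min_le[OF D D_sym n, of l]
    by (auto simp: l_def)
  finally show "lambda_min D = lambda_min P \<longleftrightarrow>
      eigenvalue_multiplicity (P - lambda_min P \<cdot>\<^sub>m G) 0 \<ge> 2"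
    unfolding B_def l_def by (rule sym)
qed

section \<open>Spheres and the forms \<open>\<Gamma>\<close> and \<open>\<Gamma>\<^sub>2\<close>\<close>

text \<open>Keeps \<open>sphere E 1 x\<close> from being rewritten to
  \<open>sphere E (Suc 0) x\<close>.\<close>

declare One_nat_def [simp del]

text \<open>A nonempty set of walk lengths attains its infimum at its least element, and the empty
  set has infimum \<open>\<infinity>\<close>; so a finite distance is a least walk length.\<close>

lemma graph_dist_eq_enat_iff:
  "graph_dist E x y = enat r \<longleftrightarrow> (E ^^ r) x y \<and> (\<forall>k<r. \<not> (E ^^ k) x y)"
proof -
  let ?A = "{n. (E ^^ n) x y}"
  have least: "graph_dist E x y = enat l" if "(E ^^ l) x y" "\<forall>k<l. \<not> (E ^^ k) x y" for l
    unfolding graph_dist_def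
  proof (rule antisym)
    show "(INF n\<in>?A. enat n) \<le> enat l" using that by (intro INF_lower) simp
    show "enat l \<le> (INF n\<in>?A. enat n)"
      using that by (intro INF_greatest) (auto simp: not_less[symmetric])
  qed
  show ?thesis
  proof
    assume r: "graph_dist E x y = enat r"
    have "?A \<noteq> {}"
    proof
      assume "?A = {}"
      hence "graph_dist E x y = \<infinity>" by (simp add: graph_dist_def Inf_enat_def)
      with r show False by simp
    qed
    then obtain n where "(E ^^ n) x y" by auto
    from LeastI[of "\<lambda>n. (E ^^ n) x y", OF this]
    have l: "(E ^^ (LEAST n. (E ^^ n) x y)) x y" "\<forall>k<(LEAST n. (E ^^ n) x y). \<not> (E ^^ k) x y"
      using not_less_Least[of _ "\<lambda>n. (E ^^ n) x y"] by auto
    with least[OF l] r show "(E ^^ r) x y \<and> (\<forall>k<r. \<not> (E ^^ k) x y)" by simp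
  qed (use least in blast)
qed

text \<open>After expanding, symmetry of \<open>k\<close> identifies the two sums of pure squares.
  This is the passage between a form in differences and a matrix with its row sums on the
  diagonal.\<close>

lemma sum_symmetric_kernel_diff_square:
  fixes k :: "'b \<Rightarrow> 'b \<Rightarrow> real"
  assumes "\<And>i j. k i j = k j i"
  shows "(\<Sum>i\<in>I. \<Sum>j\<in>I. k i j * (a i - a j)\<^sup>2)
       = 2 * (\<Sum>i\<in>I. (\<Sum>j\<in>I. k i j) * (a i)\<^sup>2) - 2 * (\<Sum>i\<in>I. \<Sum>j\<in>I. k i j * a i * a j)"
proof -
  have "(\<Sum>i\<in>I. \<Sum>j\<in>I. k i j * (a j)\<^sup>2) = (\<Sum>i\<in>I. \<Sum>j\<in>I. k i j * (a i)\<^sup>2)"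
    by (subst sum.swap) (simp add: assms)
  moreover have "(\<Sum>i\<in>I. \<Sum>j\<in>I. k i j * (a i - a j)\<^sup>2) =
      (\<Sum>i\<in>I. \<Sum>j\<in>I. k i j * (a i)\<^sup>2) + (\<Sum>i\<in>I. \<Sum>j\<in>I. k i j * (a j)\<^sup>2)
      - 2 * (\<Sum>i\<in>I. \<Sum>j\<in>I. k i j * a i * a j)"
    by (simp add: power2_diff sum.distrib sum_subtractf sum_distrib_left algebra_simps)
  ultimately show ?thesis by (simp add: sum_distrib_right)
qed

context locally_finite_simple_graph
begin

lemma adj_commute: "E u v \<longleftrightarrow> E v u"
  using sym_adj by (auto simp: symp_def)

lemma not_adj_self [simp]: "\<not> E u u"
  using no_loops by (simp add: irreflp_def)

lemma adj_weight_commute: "adj_weight E u v = adj_weight E v u"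
  by (simp add: adj_weight_def adj_commute)

section \<open>Spheres of radius one and two, and degrees as sums of weights\<close>

lemma sphere_1: "sphere E 1 x = {y. E x y}"
  by (auto simp: sphere_def graph_dist_eq_enat_iff relcompp_apply)

lemma sphere_2: "sphere E 2 x = {z. z \<noteq> x \<and> \<not> E x z \<and> (\<exists>y. E x y \<and> E y z)}"
proof -
  have "(E ^^ 2) x z \<longleftrightarrow> (\<exists>y. E x y \<and> E y z)" for z
    by (auto simp: numeral_2_eq_2 relcompp_apply)
  moreover have "(\<forall>k<2. \<not> (E ^^ k) x z) \<longleftrightarrow> z \<noteq> x \<and> \<not> E x z" for z
    by (auto simp: less_2_cases_iff)
  ultimately show ?thesis
    by (auto simp: sphere_def graph_dist_eq_enat_iff)
qed

lemma finite_sphere_1 [simp]: "finite (sphere E 1 x)"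
  by (simp only: sphere_1 finite_nbhd)

lemma finite_sphere_2 [simp]: "finite (sphere E 2 x)"
  by (rule finite_subset[of _ "\<Union>y\<in>{y. E x y}. {z. E y z}"]) (auto simp: sphere_2 finite_nbhd)

text \<open>A neighbour of \<open>y\<close> is \<open>x\<close> or has distance 1 or 2 from
  \<open>x\<close>. Encoding adjacency by weights makes the index sets independent of
  \<open>y\<close>, so that sums can be swapped later.\<close>

lemma sum_nbhd_eq_sphere_sums:
  assumes "y \<in> sphere E 1 x"
  shows "(\<Sum>w\<in>{w. E y w}. h w) = h x + (\<Sum>w\<in>sphere E 1 x. adj_weight E y w * h w)
           + (\<Sum>z\<in>sphere E 2 x. adj_weight E y z * h z)"
proof -
  have weight: "(\<Sum>w\<in>A. adj_weight E y w * h w) = sum h {w\<in>A. E y w}" if "finite A" for A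
    using that by (simp add: sum.inter_filter adj_weight_def if_distrib[of "\<lambda>c. c * a" for a] cong: if_cong)
  have "E x y" using assms by (simp add: sphere_1)
  hence "{w. E y w} = insert x ({w\<in>sphere E 1 x. E y w} \<union> {w\<in>sphere E 2 x. E y w})"
    using adj_commute by (auto simp: sphere_2 sphere_1)
  moreover have "x \<notin> {w\<in>sphere E 1 x. E y w} \<union> {w\<in>sphere E 2 x. E y w}"
    "{w\<in>sphere E 1 x. E y w} \<inter> {w\<in>sphere E 2 x. E y w} = {}"
    by (auto simp: sphere_2 sphere_1)
  moreover have "finite {w\<in>sphere E 1 x. E y w}" "finite {w\<in>sphere E 2 x. E y w}"
    by simp_all
  ultimately have "(\<Sum>w\<in>{w. E y w}. h w) =
      h x + (sum h {w\<in>sphere E 1 x. E y w} + sum h {w\<in>sphere E 2 x. E y w})"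
    by (metis finite_UnI sum.insert sum.union_disjoint)
  thus ?thesis
    by (simp add: weight)
qed

lemma deg_plus_eq_sum: "real (deg_plus E x y) = (\<Sum>z\<in>sphere E 2 x. adj_weight E y z)"
  by (simp add: deg_plus_def adj_weight_def sum.If_cases Collect_conj_eq)

lemma deg_minus_eq_sum: "real (deg_minus E x z) = (\<Sum>y\<in>sphere E 1 x. adj_weight E y z)"
proof -
  have "(\<Sum>y\<in>sphere E 1 x. adj_weight E y z) = (\<Sum>y\<in>sphere E 1 x. adj_weight E z y)"
    by (intro sum.cong adj_weight_commute refl)
  thus ?thesis by (simp add: deg_minus_def adj_weight_def sum.If_cases Collect_conj_eq)
qed

lemma deg_minus_pos:
  assumes "z \<in> sphere E 2 x"
  shows "0 < deg_minus E x z"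
proof -
  obtain y where "y \<in> {y \<in> sphere E 1 x. E z y}"
    using assms adj_commute by (auto simp: sphere_2 sphere_1)
  moreover have "finite {y \<in> sphere E 1 x. E z y}" by simp
  ultimately show ?thesis unfolding deg_minus_def card_gt_0_iff by blast
qed


lemma deg_eq_card_sphere: "deg E x = card (sphere E 1 x)"
  by (simp add: deg_def sphere_1)

lemma gamma_form_eq_sum: "gamma_form E f g x = (\<Sum>y\<in>{y. E x y}. (f y - f x) * (g y - g x)) / 2"
  by (simp add: gamma_form_def laplacian_def sum_distrib_left sum_subtractf[symmetric] algebra_simps)

text \<open>Subtracting the constant \<open>f x\<close> changes no form. A walk
  \<open>x, y, w\<close> contributes \<open>(g w - g y)^2 - 2 g y (g w - g y)\<close>, which is the
  summand on the right; the factor 4 clears the halves in both forms.\<close>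

lemma gamma2_form_eq_sum:
  fixes f :: "'v \<Rightarrow> real" and x :: 'v
  defines "g \<equiv> \<lambda>u. f u - f x"
  shows "4 * gamma2_form E f f x =
      (\<Sum>y\<in>{y. E x y}. \<Sum>w\<in>{w. E y w}. (g w)\<^sup>2 - 4 * g y * g w + 3 * (g y)\<^sup>2)
      - real (deg E x) * (\<Sum>y\<in>{y. E x y}. (g y)\<^sup>2) + 2 * (\<Sum>y\<in>{y. E x y}. g y)\<^sup>2"
proof -
  let ?N = "{y. E x y}"
  have lap: "laplacian E f y = (\<Sum>w\<in>{w. E y w}. g w - g y)" for y
    by (simp add: laplacian_def g_def)
  have gam: "2 * gamma_form E f f y = (\<Sum>w\<in>{w. E y w}. (g w - g y)\<^sup>2)" for y
    by (simp add: gamma_form_eq_sum g_def power2_eq_square)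
  have g: "g x = 0" by (simp add: g_def)
  have "gamma_form E (laplacian E f) f x = gamma_form E f (laplacian E f) x"
    by (simp add: gamma_form_eq_sum mult.commute)
  hence "4 * gamma2_form E f f x =
      2 * laplacian E (gamma_form E f f) x - 2 * (2 * gamma_form E f (laplacian E f) x)"
    by (simp add: gamma2_form_def)
  also have "2 * laplacian E (gamma_form E f f) x
      = (\<Sum>y\<in>?N. 2 * gamma_form E f f y) - real (deg E x) * (2 * gamma_form E f f x)"
    by (simp add: laplacian_def sum_subtractf sum_distrib_left deg_def algebra_simps)
  also have "2 * gamma_form E f (laplacian E f) x
      = (\<Sum>y\<in>?N. g y * (laplacian E f y - laplacian E f x))"
    by (simp add: gamma_form_eq_sum g_def)
  also have "\<dots> = (\<Sum>y\<in>?N. g y * laplacian E f y) - (\<Sum>y\<in>?N. g y) * laplacian E f x"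
    by (simp add: right_diff_distrib sum_subtractf sum_distrib_right)
  finally have "4 * gamma2_form E f f x =
      (\<Sum>y\<in>?N. 2 * gamma_form E f f y - 2 * (g y * laplacian E f y))
      - real (deg E x) * (2 * gamma_form E f f x) + 2 * (\<Sum>y\<in>?N. g y) * laplacian E f x"
    by (simp add: sum_subtractf sum_distrib_left algebra_simps)
  moreover have "2 * gamma_form E f f y - 2 * (g y * laplacian E f y) =
      (\<Sum>w\<in>{w. E y w}. (g w)\<^sup>2 - 4 * g y * g w + 3 * (g y)\<^sup>2)" for y
    unfolding gam lap sum_distrib_left sum_subtractf[symmetric]
    by (intro sum.cong refl) (simp add: power2_eq_square algebra_simps)
  ultimately show ?thesis
    by (simp add: gam lap g power2_eq_square)
qed


text \<open>The quadratic form of \<open>P_inf\<close>, written in differences so that no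
  enumeration of the 1-sphere enters: expanding the squares reproduces the row sums on the diagonal
  of \<open>P_inf\<close>.\<close>

definition sphere_form :: "'v \<Rightarrow> ('v \<Rightarrow> real) \<Rightarrow> real" where
  "sphere_form x a =
     - (\<Sum>y\<in>sphere E 1 x. \<Sum>y'\<in>sphere E 1 x. P_offdiag E x y y' * (a y - a y')\<^sup>2) / 2
     - (\<Sum>y\<in>sphere E 1 x. (real (deg_plus E x y) - av_deg_plus E x) * (a y)\<^sup>2)"

lemma second_sphere_sum_commute:
  "(\<Sum>z\<in>sphere E 2 x. adj_weight E y z * adj_weight E z y' / real (deg_minus E x z))
   = (\<Sum>z\<in>sphere E 2 x. adj_weight E y' z * adj_weight E z y / real (deg_minus E x z))"
proof (rule sum.cong)
  fix z
  show "adj_weight E y z * adj_weight E z y' / real (deg_minus E x z)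
      = adj_weight E y' z * adj_weight E z y / real (deg_minus E x z)"
    using adj_weight_commute[of y z] adj_weight_commute[of z y'] by simp
qed simp

lemma P_offdiag_commute: "P_offdiag E x y y' = P_offdiag E x y' y"
  unfolding P_offdiag_def
  using adj_weight_commute[of y y'] second_sphere_sum_commute[where x = x and y = y and y' = y'] by simp

text \<open>
  The values of \<open>f\<close> on the 2-sphere enter only through the last sum, which the choice
  \<open>f z - f x = 2 / d\<^sub>z \<cdot> (\<Sum>y. w\<^bsub>yz\<^esub> (f y - f x))\<close> makes vanish.
\<close>

lemma gamma2_form_complete_square:
  fixes f :: "'v \<Rightarrow> real" and x :: 'v
  defines "a \<equiv> \<lambda>u. f u - f x"
  shows "4 * gamma2_form E f f x = 2 * K0_inf E x * (\<Sum>y\<in>sphere E 1 x. (a y)\<^sup>2) + sphere_form x a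
    + (\<Sum>z\<in>sphere E 2 x. real (deg_minus E x z) *
        (a z - 2 / real (deg_minus E x z) * (\<Sum>y\<in>sphere E 1 x. adj_weight E y z * a y))\<^sup>2)"
proof -
  let ?S1 = "sphere E 1 x" and ?S2 = "sphere E 2 x"
  define w where "w = adj_weight E"
  define d where "d z = real (deg_minus E x z)" for z
  define \<sigma> where "\<sigma> z = (\<Sum>y\<in>?S1. w y z * a y)" for z
  define s where "s y y' = (\<Sum>z\<in>?S2. w y z * w z y' / d z)" for y y'
  define A where "A = (\<Sum>y\<in>?S1. (a y)\<^sup>2)"
  define S where "S = (\<Sum>y\<in>?S1. a y)"
  define Q where "Q = (\<Sum>y\<in>?S1. \<Sum>y'\<in>?S1. w y y' * (a y - a y')\<^sup>2)"
  define R where "R = (\<Sum>y\<in>?S1. real (deg_plus E x y) * (a y)\<^sup>2)"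
  define T where "T = (\<Sum>z\<in>?S2. (\<sigma> z)\<^sup>2 / d z)"
  define Z where "Z = (\<Sum>z\<in>?S2. d z * (a z - 2 / d z * \<sigma> z)\<^sup>2)"
  have w_commute: "w u v = w v u" for u v unfolding w_def by (rule adj_weight_commute)
  have s_commute: "s y y' = s y' y" for y y'
    unfolding s_def d_def w_def by (rule second_sphere_sum_commute)
  have d_pos: "d z > 0" if "z \<in> ?S2" for z
    using deg_minus_pos[OF that] by (simp add: d_def)
  have d_sum: "d z = (\<Sum>y\<in>?S1. w y z)" for z
    unfolding d_def w_def by (rule deg_minus_eq_sum)
  have deg_plus_sum: "real (deg_plus E x y) = (\<Sum>z\<in>?S2. w y z)" for y
    unfolding w_def by (rule deg_plus_eq_sum)
  have a_x: "a x = 0" by (simp add: a_def)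

  \<comment> \<open>Each edge inside the 1-sphere is seen from both ends; adding the two views turns
    the summand into a multiple of the squared difference.\<close>
  have first_sphere: "(\<Sum>y\<in>?S1. \<Sum>y'\<in>?S1. w y y' * ((a y')\<^sup>2 - 4 * a y * a y' + 3 * (a y)\<^sup>2)) = 2 * Q"
  proof -
    have "(\<Sum>y\<in>?S1. \<Sum>y'\<in>?S1. w y y' * (a y')\<^sup>2) = (\<Sum>y\<in>?S1. \<Sum>y'\<in>?S1. w y y' * (a y)\<^sup>2)"
      by (subst sum.swap) (simp add: w_commute)
    moreover have "Q = 2 * (\<Sum>y\<in>?S1. \<Sum>y'\<in>?S1. w y y' * (a y)\<^sup>2)
        - 2 * (\<Sum>y\<in>?S1. \<Sum>y'\<in>?S1. w y y' * a y * a y')"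
      unfolding Q_def sum_symmetric_kernel_diff_square[of w, OF w_commute] sum_distrib_right ..
    moreover have "(\<Sum>y\<in>?S1. \<Sum>y'\<in>?S1. w y y' * ((a y')\<^sup>2 - 4 * a y * a y' + 3 * (a y)\<^sup>2))
        = (\<Sum>y\<in>?S1. \<Sum>y'\<in>?S1. w y y' * (a y')\<^sup>2)
          - 4 * (\<Sum>y\<in>?S1. \<Sum>y'\<in>?S1. w y y' * a y * a y')
          + 3 * (\<Sum>y\<in>?S1. \<Sum>y'\<in>?S1. w y y' * (a y)\<^sup>2)"
      by (simp add: algebra_simps sum.distrib sum_subtractf sum_distrib_left)
    ultimately show ?thesis by simp
  qed

  \<comment> \<open>Swapping the sums collects all terms containing \<open>a z\<close>, and the
    square is completed for each \<open>z\<close> separately. \<open>T\<close> is the loss,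
    \<open>Z\<close> the sum of the squares.\<close>
  have second_sphere: "(\<Sum>y\<in>?S1. \<Sum>z\<in>?S2. w y z * ((a z)\<^sup>2 - 4 * a y * a z + 3 * (a y)\<^sup>2))
      = Z - 4 * T + 3 * R"
  proof -
    have "(\<Sum>y\<in>?S1. w y z * ((a z)\<^sup>2 - 4 * a y * a z + 3 * (a y)\<^sup>2))
        = d z * (a z - 2 / d z * \<sigma> z)\<^sup>2 - 4 * ((\<sigma> z)\<^sup>2 / d z) + 3 * (\<Sum>y\<in>?S1. w y z * (a y)\<^sup>2)"
      if "z \<in> ?S2" for z
    proof -
      have "(\<Sum>y\<in>?S1. w y z * ((a z)\<^sup>2 - 4 * a y * a z + 3 * (a y)\<^sup>2))
          = d z * (a z)\<^sup>2 - 4 * a z * \<sigma> z + 3 * (\<Sum>y\<in>?S1. w y z * (a y)\<^sup>2)"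
        unfolding d_sum \<sigma>_def
        by (simp add: algebra_simps sum.distrib sum_subtractf sum_distrib_left sum_distrib_right)
      also have "d z * (a z)\<^sup>2 - 4 * a z * \<sigma> z = d z * (a z - 2 / d z * \<sigma> z)\<^sup>2 - 4 * ((\<sigma> z)\<^sup>2 / d z)"
        using d_pos[OF that] by (simp add: field_simps power2_eq_square)
      finally show ?thesis .
    qed
    hence "(\<Sum>z\<in>?S2. \<Sum>y\<in>?S1. w y z * ((a z)\<^sup>2 - 4 * a y * a z + 3 * (a y)\<^sup>2))
        = Z - 4 * T + 3 * (\<Sum>z\<in>?S2. \<Sum>y\<in>?S1. w y z * (a y)\<^sup>2)"
      by (simp add: Z_def T_def sum.distrib sum_subtractf sum_distrib_left)
    moreover have "(\<Sum>z\<in>?S2. \<Sum>y\<in>?S1. w y z * (a y)\<^sup>2) = R"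
      unfolding R_def deg_plus_sum sum_distrib_right by (rule sum.swap)
    ultimately show ?thesis by (subst sum.swap) simp
  qed

  \<comment> \<open>\<open>s\<close> weighs the two-step paths through the 2-sphere. Its row sums
    are the outer degrees because summing \<open>w y' z\<close> over \<open>y'\<close> cancels
    \<open>d z\<close>, and its own quadratic form is exactly the loss \<open>T\<close>.\<close>
  have s_form: "(\<Sum>y\<in>?S1. \<Sum>y'\<in>?S1. s y y' * (a y - a y')\<^sup>2) = 2 * R - 2 * T"
  proof -
    have "(\<Sum>y'\<in>?S1. s y y') = real (deg_plus E x y)" for y
    proof -
      have "(\<Sum>y'\<in>?S1. s y y') = (\<Sum>z\<in>?S2. \<Sum>y'\<in>?S1. w y z * w y' z / d z)"
        unfolding s_def by (subst sum.swap) (simp add: w_commute)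
      also have "\<dots> = (\<Sum>z\<in>?S2. w y z * d z / d z)"
        by (simp add: d_sum sum_distrib_left sum_divide_distrib)
      also have "\<dots> = (\<Sum>z\<in>?S2. w y z)"
        using d_pos by (intro sum.cong refl) (metis less_irrefl nonzero_mult_div_cancel_right)
      finally show ?thesis by (simp add: deg_plus_sum)
    qed
    moreover have "(\<Sum>y\<in>?S1. \<Sum>y'\<in>?S1. s y y' * a y * a y') = T"
    proof -
      have "(\<Sum>y\<in>?S1. \<Sum>y'\<in>?S1. s y y' * a y * a y')
          = (\<Sum>y\<in>?S1. \<Sum>y'\<in>?S1. \<Sum>z\<in>?S2. w y z * w y' z / d z * a y * a y')"
        unfolding s_def by (simp add: sum_distrib_right w_commute)
      also have "\<dots> = (\<Sum>y\<in>?S1. \<Sum>z\<in>?S2. \<Sum>y'\<in>?S1. w y z * w y' z / d z * a y * a y')"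
        by (intro sum.cong refl sum.swap)
      also have "\<dots> = (\<Sum>z\<in>?S2. \<Sum>y\<in>?S1. \<Sum>y'\<in>?S1. w y z * w y' z / d z * a y * a y')"
        by (rule sum.swap)
      also have "\<dots> = T"
        unfolding T_def \<sigma>_def power2_eq_square sum_product sum_divide_distrib
        by (intro sum.cong refl) simp
      finally show ?thesis .
    qed
    ultimately show ?thesis
      unfolding sum_symmetric_kernel_diff_square[of s, OF s_commute] by (simp add: R_def)
  qed

  have ones_form: "(\<Sum>y\<in>?S1. \<Sum>y'\<in>?S1. (a y - a y')\<^sup>2) = 2 * real (deg E x) * A - 2 * S\<^sup>2"
  proof -
    have "(\<Sum>y\<in>?S1. (\<Sum>y'\<in>?S1. 1) * (a y)\<^sup>2) = real (deg E x) * A"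
      by (simp add: A_def deg_eq_card_sphere sum_distrib_left)
    moreover have "(\<Sum>y\<in>?S1. \<Sum>y'\<in>?S1. 1 * a y * a y') = S\<^sup>2"
      by (simp add: S_def power2_eq_square sum_product)
    ultimately show ?thesis
      using sum_symmetric_kernel_diff_square[of "\<lambda>_ _. 1" a ?S1] by simp
  qed

  have P_form: "(\<Sum>y\<in>?S1. \<Sum>y'\<in>?S1. P_offdiag E x y y' * (a y - a y')\<^sup>2)
      = 2 * (2 * real (deg E x) * A - 2 * S\<^sup>2) - 4 * Q - 4 * (2 * R - 2 * T)"
  proof -
    have "P_offdiag E x y y' = 2 - 4 * w y y' - 4 * s y y'" for y y'
      by (simp add: P_offdiag_def w_def s_def d_def)
    thus ?thesis
      unfolding ones_form[symmetric] s_form[symmetric] Q_def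
      by (simp add: left_diff_distrib sum_subtractf sum_distrib_left mult.assoc)
  qed

  have "4 * gamma2_form E f f x =
      (\<Sum>y\<in>?S1. \<Sum>u\<in>{u. E y u}. (a u)\<^sup>2 - 4 * a y * a u + 3 * (a y)\<^sup>2)
      - real (deg E x) * A + 2 * S\<^sup>2"
    unfolding gamma2_form_eq_sum A_def S_def a_def sphere_1 ..
  also have "(\<Sum>y\<in>?S1. \<Sum>u\<in>{u. E y u}. (a u)\<^sup>2 - 4 * a y * a u + 3 * (a y)\<^sup>2)
      = (\<Sum>y\<in>?S1. 3 * (a y)\<^sup>2
          + (\<Sum>y'\<in>?S1. w y y' * ((a y')\<^sup>2 - 4 * a y * a y' + 3 * (a y)\<^sup>2))
          + (\<Sum>z\<in>?S2. w y z * ((a z)\<^sup>2 - 4 * a y * a z + 3 * (a y)\<^sup>2)))"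
    \<comment> \<open>The neighbour \<open>x\<close> of \<open>y\<close> contributes only
      \<open>3 (a y)^2\<close>, since \<open>a x = 0\<close>.\<close>
    by (intro sum.cong refl, subst sum_nbhd_eq_sphere_sums[where x = x]) (simp_all add: w_def a_x)
  also have "\<dots> = 3 * A + 2 * Q + (Z - 4 * T + 3 * R)"
    by (simp add: sum.distrib first_sphere second_sphere A_def sum_distrib_left)
  finally have "4 * gamma2_form E f f x =
      3 * A + 2 * Q + (Z - 4 * T + 3 * R) - real (deg E x) * A + 2 * S\<^sup>2" .
  moreover have "sphere_form x a =
      - (2 * (2 * real (deg E x) * A - 2 * S\<^sup>2) - 4 * Q - 4 * (2 * R - 2 * T)) / 2
      - (R - av_deg_plus E x * A)"
    unfolding sphere_form_def P_form
    by (simp add: R_def A_def left_diff_distrib sum_subtractf sum_distrib_left)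
  moreover have "2 * K0_inf E x * A = (3 + real (deg E x) - av_deg_plus E x) * A"
    by (simp add: K0_inf_def)
  ultimately have "4 * gamma2_form E f f x = 2 * K0_inf E x * A + sphere_form x a + Z"
    by (simp add: field_simps)
  thus ?thesis by (simp add: A_def Z_def \<sigma>_def d_def w_def)
qed

text \<open>The remainder \<open>Z\<close> is nonnegative and vanishes for the best extension of
  \<open>a\<close> to the 2-sphere, so testing all \<open>f\<close> amounts to testing their values
  on the 1-sphere.\<close>

lemma curvature_inequality_iff:
  fixes r K :: real
  shows "(\<forall>f. gamma2_form E f f x \<ge> r * (laplacian E f x)\<^sup>2 + K * gamma_form E f f x) \<longleftrightarrow>
    (\<forall>a. 2 * (K - K0_inf E x + 2 * real (deg E x) * r) * (\<Sum>y\<in>sphere E 1 x. (a y)\<^sup>2) \<le> sphere_form x a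
         + 4 * r * (real (deg E x) * (\<Sum>y\<in>sphere E 1 x. (a y)\<^sup>2) - (\<Sum>y\<in>sphere E 1 x. a y)\<^sup>2))"
    (is "(\<forall>f. ?L f) \<longleftrightarrow> (\<forall>a. ?R a)")
proof -
  let ?S1 = "sphere E 1 x" and ?S2 = "sphere E 2 x"
  define Z where "Z a = (\<Sum>z\<in>?S2. real (deg_minus E x z) *
        (a z - 2 / real (deg_minus E x z) * (\<Sum>y\<in>?S1. adj_weight E y z * a y))\<^sup>2)" for a
  have Z_nonneg: "Z a \<ge> 0" for a
    unfolding Z_def by (intro sum_nonneg) simp
  \<comment> \<open>Adding and subtracting \<open>4 r d |a|^2\<close>, with \<open>d\<close> the
    degree of \<open>x\<close>, turns the term \<open>- 4 r (\<Delta> f)^2\<close> into the form of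
    \<open>d I - J\<close> and the shift \<open>2 d r\<close> of \<open>K\<close>.\<close>
  have gap: "4 * (gamma2_form E f f x - (r * (laplacian E f x)\<^sup>2 + K * gamma_form E f f x)) =
      sphere_form x a + 4 * r * (real (deg E x) * (\<Sum>y\<in>?S1. (a y)\<^sup>2) - (\<Sum>y\<in>?S1. a y)\<^sup>2)
      - 2 * (K - K0_inf E x + 2 * real (deg E x) * r) * (\<Sum>y\<in>?S1. (a y)\<^sup>2) + Z a"
    if a: "a = (\<lambda>u. f u - f x)" for f a
  proof -
    have "gamma_form E f f x = (\<Sum>y\<in>?S1. (a y)\<^sup>2) / 2"
      by (simp add: gamma_form_eq_sum a sphere_1 power2_eq_square)
    moreover have "laplacian E f x = (\<Sum>y\<in>?S1. a y)"
      by (simp add: laplacian_def a sphere_1)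
    moreover have "4 * gamma2_form E f f x = 2 * K0_inf E x * (\<Sum>y\<in>?S1. (a y)\<^sup>2) + sphere_form x a + Z a"
      unfolding gamma2_form_complete_square Z_def a ..
    ultimately show ?thesis by (simp add: algebra_simps)
  qed
  show ?thesis
  proof
    assume L: "\<forall>f. ?L f"
    show "\<forall>a. ?R a"
    proof
      fix a
      \<comment> \<open>The extension of \<open>a\<close> with value 0 at \<open>x\<close> and, on
        the 2-sphere, the values that make every square in \<open>Z\<close> vanish.\<close>
      define f where "f u = (if u = x then 0 else if u \<in> ?S2 then
          2 / real (deg_minus E x u) * (\<Sum>y\<in>?S1. adj_weight E y u * a y) else a u)" for u
      have f_x: "f = (\<lambda>u. f u - f x)" by (rule ext) (simp add: f_def)
      have f_S1: "f y = a y" if "y \<in> ?S1" for y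
        using that by (auto simp: f_def sphere_1 sphere_2)
      have f_S2: "f z = 2 / real (deg_minus E x z) * (\<Sum>y\<in>?S1. adj_weight E y z * a y)" if "z \<in> ?S2" for z
        using that by (auto simp: f_def sphere_2)
      have "Z f = 0" unfolding Z_def by (simp add: f_S1 f_S2)
      moreover have "sphere_form x f = sphere_form x a" by (simp add: sphere_form_def f_S1)
      moreover have "?L f" using L ..
      ultimately show "?R a" using gap[OF f_x] by (simp add: f_S1 cong: sum.cong)
    qed
  next
    assume R: "\<forall>a. ?R a"
    show "\<forall>f. ?L f"
    proof
      fix f
      have "?R (\<lambda>u. f u - f x)" using R ..
      hence "0 \<le> 4 * (gamma2_form E f f x - (r * (laplacian E f x)\<^sup>2 + K * gamma_form E f f x))"
        unfolding gap[OF refl] by (intro add_nonneg_nonneg Z_nonneg) simp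
      thus "?L f" by simp
    qed
  qed
qed

section \<open>The curvature as a smallest eigenvalue\<close>

lemma bij_betw_nth_sphere_1:
  assumes "distinct ys" "set ys = sphere E 1 x"
  shows "bij_betw ((!) ys) {..<deg E x} (sphere E 1 x)"
  using bij_betw_nth[OF assms(1) refl refl] assms distinct_card[OF assms(1)]
  by (simp add: deg_eq_card_sphere)

lemma P_inf_quadratic_form:
  fixes a :: "'v \<Rightarrow> real"
  assumes ys: "distinct ys" "set ys = sphere E 1 x"
  shows "(\<Sum>i<deg E x. \<Sum>j<deg E x. P_inf E x ys $$ (i, j) * a (ys ! i) * a (ys ! j)) = sphere_form x a"
proof -
  let ?n = "deg E x"
  define v where "v i = a (ys ! i)" for i
  define p where "p i j = P_offdiag E x (ys ! i) (ys ! j)" for i j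
  \<comment> \<open>The diagonal of \<open>p\<close> is cleared to match the off-diagonal part of
    \<open>P_inf\<close>; the form in differences does not see this change.\<close>
  define q where "q i j = (if i = j then 0 else p i j)" for i j
  define b where "b i = real (deg_plus E x (ys ! i)) - av_deg_plus E x" for i
  note reindex = sum.reindex_bij_betw[OF bij_betw_nth_sphere_1[OF ys], symmetric]
  have q_commute: "q i j = q j i" for i j
    by (simp add: q_def p_def P_offdiag_commute)
  have entry: "P_inf E x ys $$ (i, j) = q i j - (if i = j then (\<Sum>k<?n. q i k) + b i else 0)"
    if "i < ?n" "j < ?n" for i j
  proof -
    have "(\<Sum>k\<in>{..<?n} - {i}. p i k) = (\<Sum>k<?n. q i k)"
      using that by (intro sum.mono_neutral_cong_left) (auto simp: q_def)
    thus ?thesis using that by (auto simp: P_inf_def p_def[symmetric] q_def b_def)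
  qed
  have "(\<Sum>i<?n. \<Sum>j<?n. P_inf E x ys $$ (i, j) * v i * v j)
      = (\<Sum>i<?n. \<Sum>j<?n. q i j * v i * v j - (if i = j then ((\<Sum>k<?n. q i k) + b i) * (v i)\<^sup>2 else 0))"
    by (intro sum.cong refl) (simp add: entry algebra_simps power2_eq_square)
  also have "\<dots> = (\<Sum>i<?n. \<Sum>j<?n. q i j * v i * v j) - (\<Sum>i<?n. (\<Sum>k<?n. q i k) * (v i)\<^sup>2)
      - (\<Sum>i<?n. b i * (v i)\<^sup>2)"
    by (simp add: sum_subtractf sum.distrib distrib_right)
  also have "\<dots> = - (\<Sum>i<?n. \<Sum>j<?n. q i j * (v i - v j)\<^sup>2) / 2 - (\<Sum>i<?n. b i * (v i)\<^sup>2)"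
    unfolding sum_symmetric_kernel_diff_square[of q, OF q_commute] by simp
  also have "(\<Sum>i<?n. \<Sum>j<?n. q i j * (v i - v j)\<^sup>2) = (\<Sum>i<?n. \<Sum>j<?n. p i j * (v i - v j)\<^sup>2)"
    by (intro sum.cong refl) (simp add: q_def)
  finally show ?thesis
    unfolding sphere_form_def reindex p_def v_def b_def .
qed

end

text \<open>The block \<open>D\<close> of the overview, in the shape it has in
  \<open>bordered_lambda_min\<close>, so that this result applies by folding.\<close>

definition P_block :: "('v \<Rightarrow> 'v \<Rightarrow> bool) \<Rightarrow> 'v \<Rightarrow> 'v list \<Rightarrow> ereal \<Rightarrow> real mat" where
  "P_block E x ys N = mat (deg E x) (deg E x) (\<lambda>(i, j). P_hat E x ys N $$ (Suc i, Suc j))"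

section \<open>Entries, symmetry and row sums of \<open>P_hat\<close>\<close>

lemma P_hat_carrier: "P_hat E x ys N \<in> carrier_mat (Suc (deg E x)) (Suc (deg E x))"
  by (rule carrier_matI) (simp_all add: P_hat_def P_hat_inf_def P_inf_def all_ones_mat_def)

lemma P_hat_entry:
  assumes "i < Suc (deg E x)" "j < Suc (deg E x)"
  shows "P_hat E x ys N $$ (i, j) =
    (case (i, j) of
       (0, 0) \<Rightarrow> 0
     | (0, Suc j') \<Rightarrow> real (deg_plus E x (ys ! j')) - av_deg_plus E x
     | (Suc i', 0) \<Rightarrow> real (deg_plus E x (ys ! i')) - av_deg_plus E x
     | (Suc i', Suc j') \<Rightarrow> P_inf E x ys $$ (i', j')
         + 4 * recip_dim N * (real (deg E x) * (if i' = j' then 1 else 0) - 1))"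
  using assms
  by (cases i; cases j) (auto simp: P_hat_def P_hat_inf_def all_ones_mat_def P_inf_def)

context locally_finite_simple_graph
begin

lemma P_inf_commute:
  assumes "i < deg E x" "j < deg E x"
  shows "P_inf E x ys $$ (i, j) = P_inf E x ys $$ (j, i)"
  using assms by (auto simp: P_inf_def P_offdiag_commute)

lemma transpose_P_hat: "transpose_mat (P_hat E x ys N) = P_hat E x ys N"
proof (rule eq_matI, goal_cases)
  case (1 i j)
  hence "i < Suc (deg E x)" "j < Suc (deg E x)" using P_hat_carrier[of E x ys N] by auto
  thus ?case
    using P_hat_carrier[of E x ys N] P_inf_commute
    by (auto simp: P_hat_entry split: nat.split)
qed (use P_hat_carrier[of E x ys N] in auto)

text \<open>In row 0 the outer degrees are centred at their average. In the other rows the border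
  entry cancels the correction on the diagonal of \<open>P_inf\<close>, and the rows of
  \<open>d I - J\<close> sum to zero.\<close>

lemma P_hat_row_sum:
  assumes ys: "distinct ys" "set ys = sphere E 1 x" and deg: "0 < deg E x" and i: "i \<le> deg E x"
  shows "(\<Sum>j\<le>deg E x. P_hat E x ys N $$ (i, j)) = 0"
proof -
  let ?n = "deg E x"
  have split: "(\<Sum>j\<le>?n. P_hat E x ys N $$ (i, j))
      = P_hat E x ys N $$ (i, 0) + (\<Sum>j<?n. P_hat E x ys N $$ (i, Suc j))"
    by (simp only: lessThan_Suc_atMost[symmetric] sum.lessThan_Suc_shift)
  show ?thesis
  proof (cases i)
    case 0
    have "(\<Sum>j<?n. real (deg_plus E x (ys ! j))) = real ?n * av_deg_plus E x"
      using deg by (simp add: av_deg_plus_def sum.reindex_bij_betw[OF bij_betw_nth_sphere_1[OF ys], symmetric])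
    thus ?thesis unfolding split using 0 by (simp add: P_hat_entry sum_subtractf)
  next
    case (Suc k)
    hence k: "k < ?n" using i by simp
    have "(\<Sum>j<?n. P_inf E x ys $$ (k, j))
        = P_inf E x ys $$ (k, k) + (\<Sum>j\<in>{..<?n} - {k}. P_inf E x ys $$ (k, j))"
      using k by (intro sum.remove) auto
    also have "(\<Sum>j\<in>{..<?n} - {k}. P_inf E x ys $$ (k, j))
        = (\<Sum>j\<in>{..<?n} - {k}. P_offdiag E x (ys ! k) (ys ! j))"
      using k by (intro sum.cong refl) (auto simp: P_inf_def)
    finally have "(\<Sum>j<?n. P_inf E x ys $$ (k, j)) = - (real (deg_plus E x (ys ! k)) - av_deg_plus E x)"
      using k by (simp add: P_inf_def)
    moreover have "(\<Sum>j<?n. real ?n * (if k = j then 1 else 0) - 1) = 0"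
      using k by (simp add: sum_subtractf if_distrib[of "\<lambda>c. real ?n * c"] cong: if_cong)
    ultimately show ?thesis
      unfolding split using Suc k by (simp add: P_hat_entry sum.distrib sum_distrib_left[symmetric])
  qed
qed

lemma P_block_carrier: "P_block E x ys N \<in> carrier_mat (deg E x) (deg E x)"
  by (simp add: P_block_def)

lemma P_block_entry:
  assumes "i < deg E x" "j < deg E x"
  shows "P_block E x ys N $$ (i, j) = P_inf E x ys $$ (i, j)
    + 4 * recip_dim N * (real (deg E x) * (if i = j then 1 else 0) - 1)"
  using assms by (simp add: P_block_def P_hat_entry)

lemma transpose_P_block: "transpose_mat (P_block E x ys N) = P_block E x ys N"
  using P_block_carrier[of x ys N] P_inf_commute
  by (intro eq_matI) (auto simp: P_block_entry)

text \<open>Identifies the two sides of \<open>curvature_inequality_iff\<close> with those of a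
  Rayleigh inequality for \<open>P_block\<close>: \<open>J\<close> yields the square of the sum,
  \<open>I\<close> the sum of squares.\<close>

lemma P_block_quadratic_form:
  fixes a :: "'v \<Rightarrow> real"
  assumes ys: "distinct ys" "set ys = sphere E 1 x"
  defines "v \<equiv> vec (deg E x) (\<lambda>i. a (ys ! i))"
  shows "v \<bullet> (P_block E x ys N *\<^sub>v v) = sphere_form x a + 4 * recip_dim N *
    (real (deg E x) * (\<Sum>y\<in>sphere E 1 x. (a y)\<^sup>2) - (\<Sum>y\<in>sphere E 1 x. a y)\<^sup>2)"
    and "v \<bullet> v = (\<Sum>y\<in>sphere E 1 x. (a y)\<^sup>2)"
proof -
  let ?n = "deg E x"
  note reindex = sum.reindex_bij_betw[OF bij_betw_nth_sphere_1[OF ys], symmetric]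
  define u where "u i = a (ys ! i)" for i
  have "v \<bullet> (P_block E x ys N *\<^sub>v v) = (\<Sum>i<?n. \<Sum>j<?n. P_block E x ys N $$ (i, j) * u i * u j)"
    unfolding v_def u_def by (rule quadratic_form_vec[OF P_block_carrier])
  also have "\<dots> = (\<Sum>i<?n. \<Sum>j<?n. P_inf E x ys $$ (i, j) * u i * u j
      + (4 * recip_dim N * ((if i = j then real ?n * (u i)\<^sup>2 else 0) - u i * u j)))"
    by (intro sum.cong refl) (simp add: P_block_entry algebra_simps power2_eq_square)
  also have "\<dots> = (\<Sum>i<?n. \<Sum>j<?n. P_inf E x ys $$ (i, j) * u i * u j)
      + 4 * recip_dim N * (real ?n * (\<Sum>i<?n. (u i)\<^sup>2) - (\<Sum>i<?n. u i)\<^sup>2)"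
  proof -
    have "(\<Sum>i<?n. \<Sum>j<?n. u i * u j) = (\<Sum>i<?n. u i)\<^sup>2"
      by (simp only: power2_eq_square sum_product)
    hence "(\<Sum>i<?n. \<Sum>j<?n. (if i = j then real ?n * (u i)\<^sup>2 else 0) - u i * u j)
        = real ?n * (\<Sum>i<?n. (u i)\<^sup>2) - (\<Sum>i<?n. u i)\<^sup>2"
      by (simp add: sum_subtractf sum_distrib_left[symmetric])
    thus ?thesis by (simp only: sum.distrib sum_distrib_left[symmetric])
  qed
  also have "(\<Sum>i<?n. \<Sum>j<?n. P_inf E x ys $$ (i, j) * u i * u j) = sphere_form x a"
    unfolding u_def by (rule P_inf_quadratic_form[OF ys])
  finally show "v \<bullet> (P_block E x ys N *\<^sub>v v) = sphere_form x a + 4 * recip_dim N *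
    (real (deg E x) * (\<Sum>y\<in>sphere E 1 x. (a y)\<^sup>2) - (\<Sum>y\<in>sphere E 1 x. a y)\<^sup>2)"
    unfolding u_def reindex .
  show "v \<bullet> v = (\<Sum>y\<in>sphere E 1 x. (a y)\<^sup>2)"
    unfolding reindex v_def by (simp add: scalar_prod_def lessThan_atLeast0 power2_eq_square)
qed

text \<open>The admissible \<open>K\<close> form the half-line below \<open>?K\<close>, by the
  Rayleigh characterisation of the smallest eigenvalue; hence the greatest one exists and is
  \<open>?K\<close>.\<close>

lemma curvature_eq:
  assumes ys: "distinct ys" "set ys = sphere E 1 x" and deg: "0 < deg E x"
  shows "curvature E x N =
    K0_inf E x - 2 * real (deg E x) * recip_dim N + lambda_min (P_block E x ys N) / 2"
    (is "_ = ?K")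
proof -
  let ?n = "deg E x" and ?D = "P_block E x ys N"
  note D = P_block_carrier[of x ys N] transpose_P_block[of x ys N] deg
  \<comment> \<open>Distinctness of \<open>ys\<close> allows entries to be read back as values at
    vertices, so functions on the vertices reach every vector.\<close>
  have vec_of_fun: "\<exists>a. v = vec ?n (\<lambda>i. a (ys ! i))" if v: "v \<in> carrier_vec ?n" for v :: "real vec"
  proof -
    have inj: "inj_on ((!) ys) {..<?n}"
      using bij_betw_nth_sphere_1[OF ys] by (rule bij_betw_imp_inj_on)
    have "v = vec ?n (\<lambda>i. v $ (the_inv_into {..<?n} ((!) ys) (ys ! i)))"
      using v inj by (auto simp: the_inv_into_f_f)
    thus ?thesis by (intro exI[of _ "\<lambda>y. v $ (the_inv_into {..<?n} ((!) ys) y)"])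
  qed
  have iff: "(\<forall>f. gamma2_form E f f x \<ge> recip_dim N * (laplacian E f x)\<^sup>2 + K * gamma_form E f f x)
      \<longleftrightarrow> K \<le> ?K" for K
  proof -
    define m where "m = 2 * (K - K0_inf E x + 2 * real (deg E x) * recip_dim N)"
    have "(\<forall>f. gamma2_form E f f x \<ge> recip_dim N * (laplacian E f x)\<^sup>2 + K * gamma_form E f f x)
        \<longleftrightarrow> (\<forall>a. let v = vec ?n (\<lambda>i. a (ys ! i)) in m * (v \<bullet> v) \<le> v \<bullet> (?D *\<^sub>v v))"
      unfolding Let_def P_block_quadratic_form[OF ys] m_def by (rule curvature_inequality_iff)
    also have "\<dots> \<longleftrightarrow> (\<forall>v \<in> carrier_vec ?n. m * (v \<bullet> v) \<le> v \<bullet> (?D *\<^sub>v v))"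
    proof (intro iffI ballI allI)
      fix v :: "real vec"
      assume "\<forall>a. let v = vec ?n (\<lambda>i. a (ys ! i)) in m * (v \<bullet> v) \<le> v \<bullet> (?D *\<^sub>v v)" "v \<in> carrier_vec ?n"
      thus "m * (v \<bullet> v) \<le> v \<bullet> (?D *\<^sub>v v)" unfolding Let_def using vec_of_fun by blast
    next
      fix a :: "'v \<Rightarrow> real"
      assume *: "\<forall>v \<in> carrier_vec ?n. m * (v \<bullet> v) \<le> v \<bullet> (?D *\<^sub>v v)"
      show "let v = vec ?n (\<lambda>i. a (ys ! i)) in m * (v \<bullet> v) \<le> v \<bullet> (?D *\<^sub>v v)"
        unfolding Let_def by (rule bspec[OF *]) simp
    qed
    also have "\<dots> \<longleftrightarrow> m \<le> lambda_min ?D"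
    proof
      assume m: "\<forall>v \<in> carrier_vec ?n. m * (v \<bullet> v) \<le> v \<bullet> (?D *\<^sub>v v)"
      \<comment> \<open>An eigenvector for the smallest eigenvalue is the extremal test
        vector.\<close>
      obtain w where w: "w \<in> carrier_vec ?n" "w \<noteq> 0\<^sub>v ?n" "?D *\<^sub>v w = lambda_min ?D \<cdot>\<^sub>v w"
        using eigenvalue_lambda_min[OF D] D(1) by (auto simp: eigenvalue_def eigenvector_def)
      hence "m * (w \<bullet> w) \<le> lambda_min ?D * (w \<bullet> w)" using m by force
      thus "m \<le> lambda_min ?D" using scalar_prod_self_pos[OF w(1,2)] by simp
    next
      assume m: "m \<le> lambda_min ?D"
      show "\<forall>v \<in> carrier_vec ?n. m * (v \<bullet> v) \<le> v \<bullet> (?D *\<^sub>v v)"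
      proof
        fix v :: "real vec" assume v: "v \<in> carrier_vec ?n"
        have "0 \<le> v \<bullet> v" by (simp add: scalar_prod_def sum_nonneg)
        hence "m * (v \<bullet> v) \<le> lambda_min ?D * (v \<bullet> v)" using m by (rule mult_right_mono[rotated])
        also have "\<dots> \<le> v \<bullet> (?D *\<^sub>v v)" by (rule lambda_min_rayleigh[OF D v])
        finally show "m * (v \<bullet> v) \<le> v \<bullet> (?D *\<^sub>v v)" .
      qed
    qed
    also have "\<dots> \<longleftrightarrow> K \<le> ?K" by (auto simp: m_def field_simps)
    finally show ?thesis .
  qed
  show ?thesis
    unfolding curvature_def iff by (intro Greatest_equality) auto
qed

end

section \<open>The estimate and its equality case\<close>

theorem theorem5p5:
  fixes E :: "'v \<Rightarrow> 'v \<Rightarrow> bool" and x :: 'v and ys :: "'v list" and N :: ereal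
  assumes "locally_finite_simple_graph E"
    and "deg E x \<ge> 1"
    and "distinct ys" and "set ys = sphere E 1 x"
    and "0 < N"
  shows "curvature E x N
           \<ge> K0_inf E x - 2 * real (deg E x) * recip_dim N + 1 / 2 * lambda_min (P_hat E x ys N)
       \<and> (curvature E x N
            = K0_inf E x - 2 * real (deg E x) * recip_dim N + 1 / 2 * lambda_min (P_hat E x ys N)
          \<longleftrightarrow> eigenvalue_multiplicity
                (P_hat E x ys N - lambda_min (P_hat E x ys N) \<cdot>\<^sub>m two_Gamma_mat E x) 0 \<ge> 2)"
proof -
  interpret locally_finite_simple_graph E by fact
  note ys = \<open>distinct ys\<close> \<open>set ys = sphere E 1 x\<close>
  have deg: "0 < deg E x" using \<open>deg E x \<ge> 1\<close> by simp
  \<comment> \<open>Folding turns the abstract \<open>D\<close> and \<open>G\<close> into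
    \<open>P_block\<close> and \<open>two_Gamma_mat\<close>. Since the curvature is given exactly by
    \<open>lambda_min\<close> of \<open>P_block\<close>, both claims become the comparison of the
    two smallest eigenvalues.\<close>
  note bordered = bordered_lambda_min[OF P_hat_carrier transpose_P_hat deg P_hat_row_sum[OF ys deg],
      folded P_block_def two_Gamma_mat_def]
  have "curvature E x N = K0_inf E x - 2 * real (deg E x) * recip_dim N
      + 1 / 2 * lambda_min (P_block E x ys N)"
    using curvature_eq[OF ys deg] by simp
  thus ?thesis
    using bordered[of N] by simp
qed

end
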